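(* Let $X$ be a Banach space such that the closed unit ball $B_{X^*}$ of its dual space is weak$^*$ sequentially compact. If $X^*$ has the weak$^*$ uniform Kadec-Klee property, then $X$ has the weak fixed point property for nonexpansive mappings.
   Context: A map $T:C\to C$ on a subset $C$ of a Banach space is nonexpansive if $\|Tx-Ty\|\le\|x-y\|$ for all $x,y\in C$. A Banach space $X$ has the weak fixed point property (for nonexpansive mappings) if, for every nonempty, weakly compact, convex subset $C$ of $X$, every nonexpansive mapping of $C$ into itself has a fixed point. For a sequence $(x_n^* )$ in a dual space $X^*$, put $\mathrm{sep}(x_n^* )=\inf\{\|x_n^*-x_m^*\| : m\neq n\}$. The dual space $X^*$ has the weak$^*$ uniform Kadec-Klee property if, for every $\varepsilon>0$, there exists $\delta>0$ such that, whenever $(x_n^* )$ is a sequence in the closed unit ball of $X^*$ converging weak$^*$ to $x^*$ with $\mathrm{sep}(x_n^* )>\varepsilon$, then $\|x^*\|<1-\delta$. *)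

theory Defs
  imports "HOL-Analysis.Analysis"
begin

text \<open>
  The dual of a real normed space \<open>'a\<close> is the type \<open>'a \<Rightarrow>\<^sub>L real\<close> with the operator norm.
  On function types \<open>euclidean\<close> is the product topology, that is, the topology of pointwise
  convergence. Hence the library's \<open>strong_operator_topology\<close>, taken at scalar range, is
  the weak* topology, and the pullback of the same product topology along the evaluation map
  \<open>x \<mapsto> (\<lambda>f. f x)\<close> is the weak topology.
\<close>

abbreviation weak_star_topology :: "('a::real_normed_vector \<Rightarrow>\<^sub>L real) topology"
  where "weak_star_topology \<equiv> strong_operator_topology"

definition weak_topology :: "'a::real_normed_vector topology"
  where "weak_topology =
    pullback_topology UNIV (\<lambda>x (f :: 'a \<Rightarrow>\<^sub>L real). blinfun_apply f x) euclidean"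

lemma topspace_weak_topology [simp]: "topspace weak_topology = UNIV"
  by (simp add: weak_topology_def topspace_pullback_topology)

lemma continuous_map_into_weak_topology_iff:
  fixes g :: "'b \<Rightarrow> 'a::real_normed_vector"
  shows "continuous_map T weak_topology g \<longleftrightarrow>
    (\<forall>f :: 'a \<Rightarrow>\<^sub>L real. continuous_map T euclideanreal (\<lambda>y. blinfun_apply f (g y)))"
proof -
  let ?ev = "\<lambda>x (f :: 'a \<Rightarrow>\<^sub>L real). blinfun_apply f x"
  have "continuous_map T weak_topology g \<longleftrightarrow> continuous_map T euclidean (?ev \<circ> g)"
  proof
    assume "continuous_map T weak_topology g"
    moreover have "continuous_map weak_topology euclidean (id \<circ> ?ev)"
      unfolding weak_topology_def by (rule continuous_map_pullback) auto
    ultimately show "continuous_map T euclidean (?ev \<circ> g)"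
      by (metis continuous_map_compose id_comp)
  next
    assume "continuous_map T euclidean (?ev \<circ> g)"
    then show "continuous_map T weak_topology g"
      unfolding weak_topology_def by (rule continuous_map_pullback') auto
  qed
  then show ?thesis
    using continuous_map_componentwise_UNIV[of T "\<lambda>f :: 'a \<Rightarrow>\<^sub>L real. euclideanreal" "?ev \<circ> g"]
    unfolding euclidean_product_topology o_def by blast
qed

lemma limitin_weak_star_topology_iff:
  fixes l :: "'a::real_normed_vector \<Rightarrow>\<^sub>L real"
  shows "limitin weak_star_topology f l F \<longleftrightarrow>
    (\<forall>x. ((\<lambda>n. blinfun_apply (f n) x) \<longlongrightarrow> blinfun_apply l x) F)"
proof -
  have "limitin weak_star_topology f l F \<longleftrightarrow>
      limitin euclidean (\<lambda>n. blinfun_apply (f n)) (blinfun_apply l) F"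
  proof
    assume L: "limitin weak_star_topology f l F"
    show "limitin euclidean (\<lambda>n. blinfun_apply (f n)) (blinfun_apply l) F"
      unfolding limitin_def
    proof (intro conjI allI impI)
      fix U :: "('a \<Rightarrow> real) set"
      assume U: "openin euclidean U \<and> blinfun_apply l \<in> U"
      then have "openin weak_star_topology (blinfun_apply -` U)"
        unfolding strong_operator_topology_def openin_pullback_topology by auto
      with L U have "\<forall>\<^sub>F n in F. f n \<in> blinfun_apply -` U"
        unfolding limitin_def by blast
      then show "\<forall>\<^sub>F n in F. blinfun_apply (f n) \<in> U" by (simp only: vimage_eq)
    qed simp
  next
    assume L: "limitin euclidean (\<lambda>n. blinfun_apply (f n)) (blinfun_apply l) F"
    show "limitin weak_star_topology f l F"
      unfolding limitin_def
    proof (intro conjI allI impI)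
      fix V :: "('a \<Rightarrow>\<^sub>L real) set"
      assume "openin weak_star_topology V \<and> l \<in> V"
      then obtain U where U: "openin euclidean U" "V = blinfun_apply -` U" "blinfun_apply l \<in> U"
        unfolding strong_operator_topology_def openin_pullback_topology by auto
      with L have "\<forall>\<^sub>F n in F. blinfun_apply (f n) \<in> U"
        unfolding limitin_def by blast
      then show "\<forall>\<^sub>F n in F. f n \<in> V" by (simp only: U(2) vimage_eq)
    qed (simp add: strong_operator_topology_topspace)
  qed
  also have "\<dots> \<longleftrightarrow> (\<forall>x. ((\<lambda>n. blinfun_apply (f n) x) \<longlongrightarrow> blinfun_apply l x) F)"
    using limitin_componentwise[of "\<lambda>x :: 'a. euclideanreal" UNIV "\<lambda>n. blinfun_apply (f n)"
        "blinfun_apply l" F]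
    unfolding euclidean_product_topology by simp
  finally show ?thesis .
qed

definition seq_compactin :: "'a topology \<Rightarrow> 'a set \<Rightarrow> bool"
  where "seq_compactin T S \<longleftrightarrow> S \<subseteq> topspace T \<and>
    (\<forall>\<sigma> :: nat \<Rightarrow> 'a. range \<sigma> \<subseteq> S \<longrightarrow>
      (\<exists>l\<in>S. \<exists>r :: nat \<Rightarrow> nat. strict_mono r \<and> limitin T (\<sigma> \<circ> r) l sequentially))"

definition nonexpansive_on :: "'a::real_normed_vector set \<Rightarrow> ('a \<Rightarrow> 'a) \<Rightarrow> bool"
  where "nonexpansive_on C T \<longleftrightarrow> (\<forall>x\<in>C. \<forall>y\<in>C. norm (T x - T y) \<le> norm (x - y))"

definition weak_fixed_point_property :: "'a::banach itself \<Rightarrow> bool"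
  where "weak_fixed_point_property _ \<longleftrightarrow>
    (\<forall>C :: 'a set. C \<noteq> {} \<and> compactin weak_topology C \<and> convex C \<longrightarrow>
      (\<forall>T. T ` C \<subseteq> C \<and> nonexpansive_on C T \<longrightarrow> (\<exists>x\<in>C. T x = x)))"

definition sep :: "(nat \<Rightarrow> 'a::real_normed_vector) \<Rightarrow> real"
  where "sep x = Inf {norm (x n - x m) | n m. m \<noteq> n}"

text \<open>The argument is the type of the underlying space; the property is one of its dual.\<close>

definition dual_weak_star_UKK :: "'a::real_normed_vector itself \<Rightarrow> bool"
  where "dual_weak_star_UKK _ \<longleftrightarrow>
    (\<forall>\<epsilon>>0. \<exists>\<delta>>0. \<forall>(x :: nat \<Rightarrow> ('a \<Rightarrow>\<^sub>L real)) l.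
      range x \<subseteq> cball 0 1 \<and> limitin weak_star_topology x l sequentially \<and> sep x > \<epsilon> \<longrightarrow>
      norm l < 1 - \<delta>)"

end

theory Submission
  imports Defs
begin

text \<open>
  The weak* uniform Kadec-Klee property of the dual forces a quantitative gap in \<open>'a\<close> itself
  (\<open>weakly_null_sum_norm_bound\<close>): there is \<open>\<delta> > 0\<close> such that, if \<open>u\<close> is weakly null in the unit
  ball and \<open>v\<close> lies in the unit ball, then the norms of \<open>u\<^sub>n + v\<close> cannot all exceed \<open>2 - \<delta>\<close>. In
  the language of Garcia-Falset, the coefficient \<open>R\<close> of the space is less than 2. The reason is that
  functionals norming \<open>u\<^sub>n + v\<close> must be almost 1 both on \<open>u\<^sub>n\<close> and on \<open>v\<close>. Since \<open>u\<close> is weakly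
  null, a functional norming one term is small on a later one, so a subsequence of these functionals is
  separated; but its weak* limit is still almost 1 on \<open>v\<close>, hence has norm almost 1, which the
  Kadec-Klee property excludes.

  A fixed point free nonexpansive map contradicts this gap. Among the closed convex invariant
  subsets of the given weakly compact set there is a minimal one, \<open>K\<close>, of some diameter
  \<open>d > 0\<close>. By the lemma of Goebel and Karlovitz (\<open>goebel_karlovitz\<close>), almost fixed points of
  \<open>K\<close> have distance almost \<open>d\<close> from any prescribed point of \<open>K\<close>. Let \<open>x\<^sub>n\<close> be almost fixed
  points converging weakly to \<open>c\<close>, along some filter, and for a small \<open>s > 0\<close> let \<open>w\<^sub>n\<close> solve
  \<open>w\<^sub>n = (1 - s) T w\<^sub>n + s (x\<^sub>n + c)/2\<close>. The solution depends nonexpansively on the midpoint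
  \<open>(x\<^sub>n + c)/2\<close>, so the \<open>w\<^sub>n\<close> have mutual distances at most \<open>d/2\<close>. They are almost fixed, so their
  distance to \<open>c\<close> is almost \<open>d\<close>; and their distance to \<open>x\<^sub>n\<close> is at most about \<open>d/2\<close>. If
  \<open>b\<close> is a weak limit of \<open>w\<^sub>n\<close>, then \<open>w\<^sub>n - c\<close> splits into the weakly null part \<open>w\<^sub>n - b\<close> and the
  constant \<open>b - c\<close>, both of norm at most about \<open>d/2\<close>, while the sum has norm almost \<open>d\<close>
  (\<open>minimal_invariant_set_weak_splitting\<close>). After rescaling by about \<open>d/2\<close> this contradicts the gap.

  The functionals used above, and the interplay of norm and weak topology (Mazur's theorem,
  boundedness of weakly compact sets, lower semicontinuity of the norm), all come from
  subgradients of convex Lipschitz functions (\<open>subgradient_exists\<close>). Weak limits are taken along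
  filters that refine a given one; weak compactness produces such filters directly.
\<close>

section \<open>Subgradients of convex Lipschitz functions\<close>

text \<open>
  A form of the Hahn-Banach theorem. A minimal element \<open>g\<close> among the convex Lipschitz minorants
  of \<open>p\<close> vanishing at 0 is linear, since otherwise one could go below it: convexity makes
  \<open>v \<mapsto> g (t v) / t\<close> with \<open>0 < t \<le> 1\<close> a competitor below \<open>g\<close>, so \<open>g\<close> is positively homogeneous
  and therefore subadditive; then \<open>x \<mapsto> g (x + v) - g v\<close> is a competitor below \<open>g\<close>, so \<open>g\<close> is
  additive. The Lipschitz bound keeps infima of chains finite and bounds the resulting functional.
\<close>

lemma convex_lipschitz_linear_minorant:
  fixes p :: "'a::real_normed_vector \<Rightarrow> real"
  assumes convex: "convex_on UNIV p" and zero: "p 0 = 0"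
    and lipschitz: "\<And>u v. p u - p v \<le> norm (u - v)"
  shows "\<exists>f :: 'a \<Rightarrow>\<^sub>L real. norm f \<le> 1 \<and> (\<forall>v. blinfun_apply f v \<le> p v)"
proof -
  define S where "S = {g :: 'a \<Rightarrow> real. convex_on UNIV g \<and> g 0 = 0 \<and>
      (\<forall>u v. g u - g v \<le> norm (u - v)) \<and> g \<le> p}"
  have lower: "- norm v \<le> g v" if "g \<in> S" for g v
  proof -
    have "\<forall>u v. g u - g v \<le> norm (u - v)" "g 0 = 0"
      using that by (auto simp: S_def)
    from this(1)[rule_format, of 0 v] this(2) show ?thesis by simp
  qed
  have "\<exists>m\<in>S. \<forall>a\<in>S. a \<le> m \<longrightarrow> a = m"
  proof (rule predicate_Zorn)
    show "partial_order_on S (relation_of (\<lambda>g h. h \<le> g) S)"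
      by (rule partial_order_on_relation_ofI) auto
  next
    fix C assume C: "C \<in> Chains (relation_of (\<lambda>g h. h \<le> g) S)"
    then have CS: "C \<subseteq> S"
      by (auto simp: Chains_def relation_of_def)
    have chain: "g \<le> h \<or> h \<le> g" if "g \<in> C" "h \<in> C" for g h
      using C that by (auto simp: Chains_def relation_of_def)
    show "\<exists>u\<in>S. \<forall>a\<in>C. u \<le> a"
    proof (cases "C = {}")
      case True
      then show ?thesis using assms by (auto simp: S_def intro!: exI[of _ p])
    next
      case False
      define h where "h v = (INF g\<in>C. g v)" for v
      have bdd: "bdd_below ((\<lambda>g. g v) ` C)" for v
        using lower CS by (intro bdd_belowI2[of _ "- norm v"]) blast
      have h_le: "h v \<le> g v" if "g \<in> C" for g v
        unfolding h_def using that bdd by (rule cINF_lower[rotated])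
      have h_ge: "c \<le> h v" if "\<And>g. g \<in> C \<Longrightarrow> c \<le> g v" for c v
        unfolding h_def using False that by (rule cINF_greatest)
      have h_ex: "\<exists>g\<in>C. g v < h v + e" if "e > 0" for v e
        using h_ge[of "h v + e" v] that by (metis add_le_same_cancel1 linorder_not_le)
      have "convex_on UNIV h"
      proof (rule convex_onI)
        fix t :: real and x y :: 'a
        assume t: "0 < t" "t < 1"
        show "h ((1 - t) *\<^sub>R x + t *\<^sub>R y) \<le> (1 - t) * h x + t * h y"
        proof (rule field_le_epsilon)
          fix e :: real assume "e > 0"
          then obtain g1 g2 where g: "g1 \<in> C" "g1 x < h x + e" "g2 \<in> C" "g2 y < h y + e"
            using h_ex by meson
          \<comment> \<open>Of two comparable members of the chain, the smaller one is close to the infimum at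
            both points, which is what convexity needs.\<close>
          then obtain g where g: "g \<in> C" "g x < h x + e" "g y < h y + e"
            using chain[of g1 g2] by (metis le_fun_def order_le_less_trans)
          have "h ((1 - t) *\<^sub>R x + t *\<^sub>R y) \<le> g ((1 - t) *\<^sub>R x + t *\<^sub>R y)"
            using g h_le by blast
          also have "\<dots> \<le> (1 - t) * g x + t * g y"
            using g CS t by (intro convex_onD[of UNIV]) (auto simp: S_def)
          also have "\<dots> \<le> (1 - t) * (h x + e) + t * (h y + e)"
            using g t by (intro add_mono mult_left_mono) auto
          finally show "h ((1 - t) *\<^sub>R x + t *\<^sub>R y) \<le> (1 - t) * h x + t * h y + e"
            by (simp add: algebra_simps)
        qed
      qed simp
      moreover have "h 0 = 0"
      proof -
        have "g 0 = 0" if "g \<in> C" for g using that CS by (auto simp: S_def)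
        then show ?thesis using False h_le[of _ 0] h_ge[of 0 0] by (force intro: antisym)
      qed
      moreover have "h u - h v \<le> norm (u - v)" for u v
      proof -
        have "h u - norm (u - v) \<le> g v" if "g \<in> C" for g
        proof -
          have "g u - g v \<le> norm (u - v)" using that CS by (auto simp: S_def)
          with h_le[OF that, of u] show ?thesis by linarith
        qed
        from h_ge[OF this] show ?thesis by (simp add: algebra_simps)
      qed
      moreover have "h \<le> p"
      proof (rule le_funI)
        obtain g where "g \<in> C" using False by blast
        moreover from this have "g \<le> p" using CS by (auto simp: S_def)
        ultimately show "h v \<le> p v" for v using h_le[of g v] by (auto simp: le_fun_def intro: order_trans)
      qed
      ultimately have "h \<in> S" by (auto simp: S_def)
      with h_le show ?thesis by (auto simp: le_fun_def)
    qed
  qed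
  then obtain g where gS: "g \<in> S" and min: "\<And>h. h \<in> S \<Longrightarrow> h \<le> g \<Longrightarrow> h = g" by blast
  then have g_conv: "convex_on UNIV g" and g0: "g 0 = 0"
    and g_lip: "\<And>u v. g u - g v \<le> norm (u - v)" and g_p: "\<And>v. g v \<le> p v"
    by (auto simp: S_def le_fun_def)
  have homog: "g (t *\<^sub>R v) = t * g v" if t: "0 < t" "t \<le> 1" for t v
  proof -
    define h where "h v = g (t *\<^sub>R v) / t" for v
    have "h \<le> g"
    proof (rule le_funI)
      fix v
      have "g ((1 - t) *\<^sub>R 0 + t *\<^sub>R v) \<le> (1 - t) * g 0 + t * g v"
        using g_conv t by (intro convex_onD[of UNIV]) auto
      then show "h v \<le> g v" using t g0 by (simp add: h_def field_simps)
    qed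
    moreover have "convex_on UNIV h"
    proof (rule convex_onI)
      fix s :: real and x y :: 'a
      assume s: "0 < s" "s < 1"
      have "g ((1 - s) *\<^sub>R (t *\<^sub>R x) + s *\<^sub>R (t *\<^sub>R y)) \<le> (1 - s) * g (t *\<^sub>R x) + s * g (t *\<^sub>R y)"
        using g_conv s by (intro convex_onD[of UNIV]) auto
      moreover have "(1 - s) *\<^sub>R (t *\<^sub>R x) + s *\<^sub>R (t *\<^sub>R y) = t *\<^sub>R ((1 - s) *\<^sub>R x + s *\<^sub>R y)"
        by (simp add: algebra_simps)
      ultimately show "h ((1 - s) *\<^sub>R x + s *\<^sub>R y) \<le> (1 - s) * h x + s * h y"
        using t by (simp add: h_def divide_simps algebra_simps)
    qed simp
    moreover have "h u - h v \<le> norm (u - v)" for u v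
      using g_lip[of "t *\<^sub>R u" "t *\<^sub>R v"] t
      by (simp add: h_def divide_simps flip: scaleR_diff_right) (simp add: algebra_simps)
    ultimately have "h \<in> S"
      using g_p g0 by (auto simp: S_def h_def le_fun_def intro: order_trans)
    with \<open>h \<le> g\<close> have "h = g" by (rule min[rotated])
    then have "h v = g v" by simp
    then show ?thesis using t by (simp add: h_def field_simps)
  qed
  have add: "g (x + v) = g x + g v" for x v
  proof -
    define h where "h x = g (x + v) - g v" for x
    have "h \<le> g"
    proof (rule le_funI)
      fix x
      have "g ((1 - 1/2) *\<^sub>R x + (1/2) *\<^sub>R v) \<le> (1 - 1/2) * g x + (1/2) * g v"
        using g_conv by (rule convex_onD) auto
      moreover have "g ((1/2) *\<^sub>R (x + v)) = 1/2 * g (x + v)"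
        by (rule homog) auto
      ultimately show "h x \<le> g x" by (simp add: h_def scaleR_add_right)
    qed
    moreover have "convex_on UNIV h"
    proof (rule convex_onI)
      fix s :: real and x y :: 'a
      assume s: "0 < s" "s < 1"
      have "g ((1 - s) *\<^sub>R (x + v) + s *\<^sub>R (y + v)) \<le> (1 - s) * g (x + v) + s * g (y + v)"
        using g_conv s by (intro convex_onD[of UNIV]) auto
      moreover have "(1 - s) *\<^sub>R (x + v) + s *\<^sub>R (y + v) = (1 - s) *\<^sub>R x + s *\<^sub>R y + v"
        by (simp add: algebra_simps)
      ultimately show "h ((1 - s) *\<^sub>R x + s *\<^sub>R y) \<le> (1 - s) * h x + s * h y"
        by (simp add: h_def algebra_simps)
    qed simp
    moreover have "h u - h w \<le> norm (u - w)" for u w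
      using g_lip[of "u + v" "w + v"] by (simp add: h_def)
    ultimately have "h \<in> S"
      using g_p g0 by (auto simp: S_def h_def le_fun_def intro: order_trans)
    with \<open>h \<le> g\<close> have "h = g" by (rule min[rotated])
    then have "h x = g x" by simp
    then show ?thesis by (simp add: h_def)
  qed
  have neg: "g (- v) = - g v" for v
    using add[of v "- v"] g0 by simp
  have homog_pos: "g (t *\<^sub>R v) = t * g v" if "t > 0" for t v
  proof (cases "t \<le> 1")
    case False
    then have "g ((1 / t) *\<^sub>R (t *\<^sub>R v)) = 1 / t * g (t *\<^sub>R v)"
      by (intro homog) auto
    then show ?thesis using that by (simp add: field_simps)
  qed (use that homog in auto)
  have scale: "g (t *\<^sub>R v) = t * g v" for t v
  proof (cases t "0 :: real" rule: linorder_cases)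
    case less
    then have "g ((- t) *\<^sub>R v) = (- t) * g v" by (intro homog_pos) auto
    then show ?thesis by (simp add: neg)
  qed (use homog_pos g0 in auto)
  have abs: "\<bar>g v\<bar> \<le> norm v" for v
    using g_lip[of v 0] g_lip[of 0 v] g0 by simp
  have bl: "bounded_linear g"
    by (rule bounded_linear_intro[where K = 1]) (use add scale abs in auto)
  have "norm (Blinfun g) \<le> 1"
    by (rule norm_blinfun_bound) (use abs bl in \<open>auto simp: bounded_linear_Blinfun_apply\<close>)
  with bl g_p show ?thesis
    by (intro exI[of _ "Blinfun g"]) (auto simp: bounded_linear_Blinfun_apply)
qed

text \<open>
  The increment of \<open>\<phi>\<close> from \<open>x\<close> is again convex and Lipschitz, and vanishes at 0.
\<close>

lemma subgradient_exists:
  fixes \<phi> :: "'a::real_normed_vector \<Rightarrow> real"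
  assumes convex: "convex_on UNIV \<phi>" and lipschitz: "\<And>u v. \<phi> u - \<phi> v \<le> norm (u - v)"
  obtains f :: "'a \<Rightarrow>\<^sub>L real" where "norm f \<le> 1" "\<And>y. \<phi> x + f (y - x) \<le> \<phi> y"
proof -
  define p where "p v = \<phi> (x + v) - \<phi> x" for v
  have "convex_on UNIV p"
  proof (rule convex_onI)
    fix s :: real and u v :: 'a
    assume s: "0 < s" "s < 1"
    have "\<phi> ((1 - s) *\<^sub>R (x + u) + s *\<^sub>R (x + v)) \<le> (1 - s) * \<phi> (x + u) + s * \<phi> (x + v)"
      using convex s by (intro convex_onD[of UNIV]) auto
    moreover have "(1 - s) *\<^sub>R (x + u) + s *\<^sub>R (x + v) = x + ((1 - s) *\<^sub>R u + s *\<^sub>R v)"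
      by (simp add: algebra_simps)
    ultimately show "p ((1 - s) *\<^sub>R u + s *\<^sub>R v) \<le> (1 - s) * p u + s * p v"
      by (simp add: p_def algebra_simps)
  qed simp
  moreover have "p 0 = 0" by (simp add: p_def)
  moreover have "p u - p v \<le> norm (u - v)" for u v
    using lipschitz[of "x + u" "x + v"] by (simp add: p_def)
  ultimately obtain f :: "'a \<Rightarrow>\<^sub>L real" where f: "norm f \<le> 1" "\<And>v. f v \<le> p v"
    using convex_lipschitz_linear_minorant by blast
  have "\<phi> x + f (y - x) \<le> \<phi> y" for y
    using f(2)[of "y - x"] by (simp add: p_def)
  with f(1) show thesis by (rule that)
qed

lemma blinfun_le_norm:
  fixes f :: "'a::real_normed_vector \<Rightarrow>\<^sub>L real"
  assumes "norm f \<le> 1"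
  shows "f x \<le> norm x"
  using norm_blinfun[of f x] assms mult_right_mono[of "norm f" 1 "norm x"] by simp

text \<open>
  A subgradient \<open>f\<close> of the norm at \<open>x\<close>, tested at the origin, gives \<open>norm x - f x \<le> 0\<close>.
\<close>

lemma norming_functional:
  fixes x :: "'a::real_normed_vector"
  obtains f :: "'a \<Rightarrow>\<^sub>L real" where "norm f \<le> 1" "f x = norm x"
proof -
  have "convex_on UNIV (norm :: 'a \<Rightarrow> real)"
    by (rule convex_onI) (auto intro!: norm_triangle_le)
  then obtain f :: "'a \<Rightarrow>\<^sub>L real" where f: "norm f \<le> 1" "\<And>y. norm x + f (y - x) \<le> norm y"
    using subgradient_exists[of norm x] norm_triangle_ineq2 by blast
  have "f x \<ge> norm x"
    using f(2)[of 0] by (simp add: blinfun.minus_right)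
  moreover have "f x \<le> norm x"
    using f(1) by (rule blinfun_le_norm)
  ultimately show thesis using that f(1) by force
qed

section \<open>Closed convex sets and weak limits\<close>

lemma convex_on_infdist:
  fixes C :: "'a::real_normed_vector set"
  assumes C: "convex C" "C \<noteq> {}"
  shows "convex_on UNIV (\<lambda>x. infdist x C)"
proof (rule convex_onI)
  fix t :: real and x y :: 'a
  assume t: "0 < t" "t < 1"
  show "infdist ((1 - t) *\<^sub>R x + t *\<^sub>R y) C \<le> (1 - t) * infdist x C + t * infdist y C"
  proof (rule field_le_epsilon)
    fix e :: real assume "e > 0"
    have near: "\<exists>a\<in>C. dist z a < infdist z C + e" for z
    proof (rule ccontr)
      assume "\<not> ?thesis"
      then have "infdist z C + e \<le> infdist z C"
        unfolding infdist_notempty[OF C(2)] using C(2)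
        by (intro cINF_greatest) (auto simp: not_less infdist_notempty)
      with \<open>e > 0\<close> show False by simp
    qed
    obtain a b where a: "a \<in> C" "dist x a < infdist x C + e" and b: "b \<in> C" "dist y b < infdist y C + e"
      using near by meson
    have "(1 - t) *\<^sub>R a + t *\<^sub>R b \<in> C"
      using C(1) a b t by (intro convexD) auto
    then have "infdist ((1 - t) *\<^sub>R x + t *\<^sub>R y) C
        \<le> dist ((1 - t) *\<^sub>R x + t *\<^sub>R y) ((1 - t) *\<^sub>R a + t *\<^sub>R b)"
      by (rule infdist_le)
    also have "\<dots> = norm ((1 - t) *\<^sub>R (x - a) + t *\<^sub>R (y - b))"
      by (simp add: dist_norm algebra_simps)
    also have "\<dots> \<le> (1 - t) * dist x a + t * dist y b"
      using t by (intro norm_triangle_le) (simp add: dist_norm)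
    also have "\<dots> \<le> (1 - t) * (infdist x C + e) + t * (infdist y C + e)"
      using a b t by (intro add_mono mult_left_mono) auto
    finally show "infdist ((1 - t) *\<^sub>R x + t *\<^sub>R y) C \<le> (1 - t) * infdist x C + t * infdist y C + e"
      by (simp add: algebra_simps)
  qed
qed simp

text \<open>
  The separating functional is a subgradient of the distance function of \<open>C\<close> at \<open>x\<close>: on the
  points of \<open>C\<close>, where the distance vanishes, it must lie below \<open>f x\<close> by the distance of \<open>x\<close>.
\<close>

lemma closed_convex_separation:
  fixes C :: "'a::real_normed_vector set"
  assumes C: "closed C" "convex C" and x: "x \<notin> C"
  obtains f :: "'a \<Rightarrow>\<^sub>L real" and r where "f x > r" "\<And>c. c \<in> C \<Longrightarrow> f c \<le> r"
proof (cases "C = {}")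
  case True
  then show ?thesis using that[where f = 0 and r = "-1"] by simp
next
  case False
  obtain f :: "'a \<Rightarrow>\<^sub>L real" where f: "norm f \<le> 1" "\<And>y. infdist x C + f (y - x) \<le> infdist y C"
    using subgradient_exists[of "\<lambda>x. infdist x C" x] convex_on_infdist[OF C(2) False]
      infdist_triangle[of _ C] by (metis diff_le_eq add.commute dist_norm)
  have "infdist x C > 0"
    using C(1) False x infdist_pos_not_in_closed by blast
  moreover have "f c \<le> f x - infdist x C" if "c \<in> C" for c
    using f(2)[of c] that by (simp add: blinfun.diff_right)
  ultimately show ?thesis using that[where f = f and r = "f x - infdist x C"] by simp
qed

lemma continuous_map_weak_topology_blinfun:
  "continuous_map weak_topology euclideanreal (blinfun_apply (f :: 'a::real_normed_vector \<Rightarrow>\<^sub>L real))"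
  using continuous_map_into_weak_topology_iff[of weak_topology "\<lambda>x :: 'a. x"]
    continuous_map_id[of "weak_topology :: 'a topology"]
  by (simp add: id_def)

text \<open>
  Mazur's theorem: by separation, the set is the intersection of the closed half-spaces that
  contain it, and half-spaces are weakly closed by definition of the weak topology.
\<close>

lemma closed_convex_imp_weakly_closed:
  fixes C :: "'a::real_normed_vector set"
  assumes C: "closed C" "convex C"
  shows "closedin weak_topology C"
proof -
  define H where "H f r = {x :: 'a. blinfun_apply f x \<le> r}" for f :: "'a \<Rightarrow>\<^sub>L real" and r
  have "closedin weak_topology (H f r)" for f r
  proof -
    have "closedin weak_topology {x \<in> topspace weak_topology. blinfun_apply f x \<in> {..r}}"
      by (rule closedin_continuous_map_preimage[OF continuous_map_weak_topology_blinfun]) auto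
    then show ?thesis by (simp add: H_def)
  qed
  moreover have "C = \<Inter> ({UNIV} \<union> {H f r | f r. C \<subseteq> H f r})"
  proof
    show "\<Inter> ({UNIV} \<union> {H f r | f r. C \<subseteq> H f r}) \<subseteq> C"
    proof
      fix x assume x: "x \<in> \<Inter> ({UNIV} \<union> {H f r | f r. C \<subseteq> H f r})"
      show "x \<in> C"
      proof (rule ccontr)
        assume "x \<notin> C"
        with C obtain f :: "'a \<Rightarrow>\<^sub>L real" and r where "f x > r" "\<And>c. c \<in> C \<Longrightarrow> f c \<le> r"
          by (rule closed_convex_separation) blast
        then have "H f r \<in> {H f r | f r. C \<subseteq> H f r}" by (auto simp: H_def)
        with x have "x \<in> H f r" by blast
        with \<open>f x > r\<close> show False by (simp add: H_def)
      qed
    qed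
  qed blast
  moreover have "closedin weak_topology (UNIV :: 'a set)"
    using closedin_topspace[of "weak_topology :: 'a topology"] by simp
  ultimately show ?thesis
    by (subst \<open>C = _\<close>, intro closedin_Inter) auto
qed

text \<open>
  Convergence in the weak topology, expressed by functionals. The index filter is arbitrary because
  weak compactness supplies limits along filters, not along subsequences.
\<close>

definition weakly_tendsto :: "('b \<Rightarrow> 'a::real_normed_vector) \<Rightarrow> 'a \<Rightarrow> 'b filter \<Rightarrow> bool"
  where "weakly_tendsto g l F \<longleftrightarrow> (\<forall>f :: 'a \<Rightarrow>\<^sub>L real. ((\<lambda>n. blinfun_apply f (g n)) \<longlongrightarrow> blinfun_apply f l) F)"

lemma weakly_tendsto_diff:
  "weakly_tendsto g l F \<Longrightarrow> weakly_tendsto h m F \<Longrightarrow> weakly_tendsto (\<lambda>n. g n - h n) (l - m) F"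
  by (auto simp: weakly_tendsto_def blinfun.diff_right intro: tendsto_diff)

lemma weakly_tendsto_const: "weakly_tendsto (\<lambda>_. c) c F"
  by (simp add: weakly_tendsto_def)

lemma weakly_tendsto_mono: "weakly_tendsto g l F \<Longrightarrow> F' \<le> F \<Longrightarrow> weakly_tendsto g l F'"
  by (auto simp: weakly_tendsto_def intro: tendsto_mono)

text \<open>
  Weak lower semicontinuity of the norm: a functional norming the limit transfers the bound.
\<close>

lemma weak_limit_norm_le:
  fixes g :: "'b \<Rightarrow> 'a::real_normed_vector"
  assumes lim: "weakly_tendsto g l F" and F: "F \<noteq> bot" and le: "\<forall>\<^sub>F n in F. norm (g n) \<le> r"
  shows "norm l \<le> r"
proof -
  obtain f :: "'a \<Rightarrow>\<^sub>L real" where f: "norm f \<le> 1" "f l = norm l"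
    by (rule norming_functional)
  have "((\<lambda>n. f (g n)) \<longlongrightarrow> f l) F" using lim by (simp add: weakly_tendsto_def)
  moreover have "\<forall>\<^sub>F n in F. f (g n) \<le> r"
    using le by eventually_elim (meson blinfun_le_norm f(1) order_trans)
  ultimately show ?thesis using F f(2) tendsto_upperbound by metis
qed

text \<open>
  The substitute for extracting a weakly convergent subsequence. Evaluation embeds the set as
  a compact subset of the product space of functions on the dual, where every proper filter on the
  set has a cluster point; refining the index filter by the neighbourhoods of that point turns
  it into a limit.
\<close>

lemma weakly_compact_cluster_point:
  fixes C :: "'a::real_normed_vector set"
  assumes C: "compactin weak_topology C" and F: "F \<noteq> bot" "\<forall>\<^sub>F n in F. g n \<in> C"
  obtains F' l where "F' \<le> F" "F' \<noteq> bot" "l \<in> C" "weakly_tendsto g l F'"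
proof -
  define ev where "ev x = (\<lambda>f :: 'a \<Rightarrow>\<^sub>L real. blinfun_apply f x)" for x
  have "continuous_map weak_topology euclidean ev"
  proof -
    have "continuous_map weak_topology euclidean (id \<circ> ev)"
      unfolding weak_topology_def ev_def by (rule continuous_map_pullback) auto
    then show ?thesis by simp
  qed
  then have "compact (ev ` C)"
    using image_compactin[OF C] compactin_euclidean_iff by blast
  moreover have "filtermap (\<lambda>n. ev (g n)) F \<noteq> bot"
    using F by (simp add: filtermap_bot_iff)
  moreover have "\<forall>\<^sub>F x in filtermap (\<lambda>n. ev (g n)) F. x \<in> ev ` C"
    using F(2) by (auto simp: eventually_filtermap elim: eventually_mono)
  ultimately obtain l where l: "l \<in> C" "inf (nhds (ev l)) (filtermap (\<lambda>n. ev (g n)) F) \<noteq> bot"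
    by (auto simp: compact_filter)
  define F' where "F' = inf (filtercomap (\<lambda>n. ev (g n)) (nhds (ev l))) F"
  have "F' \<noteq> bot"
  proof
    assume "F' = bot"
    then obtain P Q where PQ: "eventually P (nhds (ev l))" "eventually Q F" "\<And>n. P (ev (g n)) \<Longrightarrow> Q n \<Longrightarrow> False"
      unfolding F'_def trivial_limit_def eventually_inf eventually_filtercomap by blast
    then have "\<forall>\<^sub>F x in filtermap (\<lambda>n. ev (g n)) F. \<not> P x"
      unfolding eventually_filtermap using PQ(3) by (intro eventually_mono[OF PQ(2)]) blast
    with PQ(1) have "\<forall>\<^sub>F x in inf (nhds (ev l)) (filtermap (\<lambda>n. ev (g n)) F). False"
      unfolding eventually_inf by blast
    with l(2) show False by (simp add: trivial_limit_def)
  qed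
  moreover have "F' \<le> F" by (simp add: F'_def)
  moreover have "weakly_tendsto g l F'"
  proof -
    have lim: "((\<lambda>n. ev (g n)) \<longlongrightarrow> ev l) F'"
      unfolding F'_def by (rule filterlim_mono[OF filterlim_filtercomap order_refl inf_le1])
    have "((\<lambda>n. ev (g n) f) \<longlongrightarrow> ev l f) F'" for f
      by (rule continuous_on_tendsto_compose[OF continuous_on_product_coordinates lim]) auto
    then show ?thesis by (simp add: weakly_tendsto_def ev_def)
  qed
  ultimately show thesis using l(1) that by blast
qed

section \<open>Weakly compact sets\<close>

lemma tendsto_imp_weakly_tendsto:
  fixes g :: "'b \<Rightarrow> 'a::real_normed_vector"
  shows "(g \<longlongrightarrow> l) F \<Longrightarrow> weakly_tendsto g l F"
  by (simp add: weakly_tendsto_def bounded_linear.tendsto[OF blinfun.bounded_linear_right])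

lemma weakly_compact_imp_closed:
  fixes C :: "'a::real_normed_vector set"
  assumes C: "compactin weak_topology C"
  shows "closed C"
  unfolding closed_sequential_limits
proof (intro allI impI, elim conjE)
  fix x l assume x: "\<forall>n. x n \<in> C" "x \<longlonglongrightarrow> l"
  obtain F m where F: "F \<le> sequentially" "F \<noteq> bot" "m \<in> C" "weakly_tendsto x m F"
    using weakly_compact_cluster_point[OF C, of sequentially x] x(1) by auto
  have "(x \<longlongrightarrow> l) F" using F(1) x(2) by (rule tendsto_mono)
  then have "weakly_tendsto (\<lambda>n. x n - x n) (m - l) F"
    by (intro weakly_tendsto_diff F tendsto_imp_weakly_tendsto)
  then have "norm (m - l) \<le> 0"
    using F(2) by (rule weak_limit_norm_le) auto
  with F(3) show "l \<in> C" by simp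
qed

text \<open>
  The uniform boundedness principle for the elements of \<open>C\<close> acting on the dual, which is complete:
  functionals are bounded on \<open>C\<close>, so by Baire's theorem some ball of functionals has a common bound
  on \<open>C\<close>, and norming functionals turn this into a bound of the norms.
\<close>

lemma weakly_compact_imp_bounded:
  fixes C :: "'a::real_normed_vector set"
  assumes C: "compactin weak_topology C"
  shows "bounded C"
proof -
  define A where "A n = {f :: 'a \<Rightarrow>\<^sub>L real. \<forall>x\<in>C. \<bar>blinfun_apply f x\<bar> \<le> real n}" for n
  have closed: "closed (A n)" for n
  proof -
    have "A n = (\<Inter>x\<in>C. {f. \<bar>blinfun_apply f x\<bar> \<le> real n})" by (auto simp: A_def)
    also have "closed \<dots>"
      by (intro closed_INT ballI closed_Collect_le continuous_intros)
    finally show ?thesis .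
  qed
  have "f \<in> \<Union> (range A)" for f
  proof -
    have "compact (blinfun_apply f ` C)"
      using image_compactin[OF C continuous_map_weak_topology_blinfun] compactin_euclidean_iff by blast
    then have "bounded (blinfun_apply f ` C)" by (rule compact_imp_bounded)
    then obtain b where b: "\<forall>x\<in>C. \<bar>f x\<bar> \<le> b"
      by (auto simp: bounded_iff)
    obtain n where "b \<le> real n" using real_arch_simple by blast
    with b have "f \<in> A n" by (force simp: A_def)
    then show ?thesis by blast
  qed
  then have union: "\<Union> (range A) = UNIV" by blast
  have "\<exists>n. interior (A n) \<noteq> {}"
  proof (rule ccontr)
    assume "\<not> ?thesis"
    then have "euclidean interior_of \<Union> (range A) = {}"
      using closed by (intro Baire_category_alt) (auto simp: completely_metrizable_space_euclidean)
    with union show False by (simp add: interior_of_topspace[of euclidean, simplified])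
  qed
  then obtain n f0 where "f0 \<in> interior (A n)" by blast
  then obtain e where e: "e > 0" "cball f0 e \<subseteq> A n"
    unfolding mem_interior_cball by blast
  have "norm x \<le> 2 * real n / e" if x: "x \<in> C" for x
  proof -
    obtain f :: "'a \<Rightarrow>\<^sub>L real" where f: "norm f \<le> 1" "f x = norm x"
      by (rule norming_functional)
    have "f0 \<in> A n" "f0 + e *\<^sub>R f \<in> A n"
      using e f(1) by (auto intro!: subsetD[OF e(2)] simp: dist_norm)
    then have "\<bar>f0 x\<bar> \<le> n" "\<bar>f0 x + e * norm x\<bar> \<le> n"
      using x f(2) by (auto simp: A_def blinfun.add_left blinfun.scaleR_left)
    then have "e * norm x \<le> 2 * real n" by linarith
    then show ?thesis using e(1) by (simp add: field_simps)
  qed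
  then show ?thesis unfolding bounded_iff by blast
qed

text \<open>
  By Mazur's theorem the finite intersection property is available for norm closed convex sets. It
  yields lower bounds of chains of invariant sets, and Chebyshev centres of families of balls.
\<close>

lemma weakly_compact_Inter_nonempty:
  fixes C :: "'a::real_normed_vector set"
  assumes C: "compactin weak_topology C"
    and U: "\<And>A. A \<in> \<U> \<Longrightarrow> closed A \<and> convex A"
    and fip: "\<And>\<F>. finite \<F> \<Longrightarrow> \<F> \<subseteq> \<U> \<Longrightarrow> C \<inter> \<Inter>\<F> \<noteq> {}"
  shows "C \<inter> \<Inter>\<U> \<noteq> {}"
proof -
  have "\<forall>A\<in>\<U>. closedin weak_topology A"
    using U closed_convex_imp_weakly_closed by blast
  moreover have "\<forall>\<F>. finite \<F> \<and> \<F> \<subseteq> \<U> \<longrightarrow> C \<inter> \<Inter>\<F> \<noteq> {}"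
    using fip by blast
  ultimately show ?thesis
    using C[unfolded compactin_fip, THEN conjunct2, THEN spec, of \<U>] by blast
qed

section \<open>Minimal invariant sets\<close>

definition invariant_set :: "('a::real_normed_vector \<Rightarrow> 'a) \<Rightarrow> 'a set \<Rightarrow> bool"
  where "invariant_set T K \<longleftrightarrow> K \<noteq> {} \<and> closed K \<and> convex K \<and> T ` K \<subseteq> K"

definition minimal_invariant_set :: "('a::real_normed_vector \<Rightarrow> 'a) \<Rightarrow> 'a set \<Rightarrow> bool"
  where "minimal_invariant_set T K \<longleftrightarrow>
    invariant_set T K \<and> (\<forall>K'. invariant_set T K' \<longrightarrow> K' \<subseteq> K \<longrightarrow> K' = K)"

lemma minimal_invariant_set_exists:
  fixes C :: "'a::real_normed_vector set"
  assumes C: "compactin weak_topology C" and inv: "invariant_set T C"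
  obtains K where "K \<subseteq> C" "minimal_invariant_set T K"
proof -
  define S where "S = {K. invariant_set T K \<and> K \<subseteq> C}"
  have "\<exists>m\<in>S. \<forall>a\<in>S. a \<subseteq> m \<longrightarrow> a = m"
  proof (rule predicate_Zorn)
    show "partial_order_on S (relation_of (\<lambda>A B. B \<subseteq> A) S)"
      by (rule partial_order_on_relation_ofI) auto
  next
    fix \<C> assume ch: "\<C> \<in> Chains (relation_of (\<lambda>A B. B \<subseteq> A) S)"
    then have CS: "\<C> \<subseteq> S"
      by (auto simp: Chains_def relation_of_def)
    have chain: "A \<subseteq> B \<or> B \<subseteq> A" if "A \<in> \<C>" "B \<in> \<C>" for A B
      using ch that by (auto simp: Chains_def relation_of_def)
    show "\<exists>u\<in>S. \<forall>a\<in>\<C>. u \<subseteq> a"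
    proof (cases "\<C> = {}")
      case True
      then show ?thesis using inv by (auto simp: S_def)
    next
      case False
      have least: "\<exists>A\<in>\<C>. A \<subseteq> \<Inter>\<F>" if "finite \<F>" "\<F> \<subseteq> \<C>" for \<F>
        using that
      proof (induction \<F>)
        case empty
        then show ?case using False by auto
      next
        case (insert B \<F>)
        then obtain A where A: "A \<in> \<C>" "A \<subseteq> \<Inter>\<F>" "B \<in> \<C>" by auto
        show ?case
        proof (cases "A \<subseteq> B")
          case True
          then show ?thesis using A by (intro bexI[of _ A]) auto
        next
          case False
          then have "B \<subseteq> A" using chain A by blast
          then show ?thesis using A by (intro bexI[of _ B]) auto
        qed
      qed
      have "C \<inter> \<Inter>\<C> \<noteq> {}"
      proof (rule weakly_compact_Inter_nonempty[OF C])
        show "closed A \<and> convex A" if "A \<in> \<C>" for A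
          using that CS by (auto simp: S_def invariant_set_def)
        show "C \<inter> \<Inter>\<F> \<noteq> {}" if \<F>: "finite \<F>" "\<F> \<subseteq> \<C>" for \<F>
        proof -
          obtain A where A: "A \<in> \<C>" "A \<subseteq> \<Inter>\<F>" using least[OF \<F>] by blast
          then have "A \<noteq> {}" "A \<subseteq> C" using CS by (auto simp: S_def invariant_set_def)
          with A(2) show ?thesis by blast
        qed
      qed
      moreover have "\<Inter>\<C> \<subseteq> C" using False CS by (auto simp: S_def)
      moreover have "closed (\<Inter>\<C>)" "convex (\<Inter>\<C>)" "T ` \<Inter>\<C> \<subseteq> \<Inter>\<C>"
        using CS by (auto simp: S_def invariant_set_def image_subset_iff intro!: closed_Inter convex_Inter)
      ultimately have "\<Inter>\<C> \<in> S" by (auto simp: S_def invariant_set_def)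
      then show ?thesis by blast
    qed
  qed
  then obtain K where K: "K \<in> S" "\<And>A. A \<in> S \<Longrightarrow> A \<subseteq> K \<Longrightarrow> A = K" by blast
  then have "K \<subseteq> C" "minimal_invariant_set T K"
    unfolding S_def minimal_invariant_set_def by auto
  then show thesis by (rule that)
qed

lemma minimal_invariant_set_subset:
  assumes "minimal_invariant_set T K" "invariant_set T K'" "K' \<subseteq> K" "x \<in> K"
  shows "x \<in> K'"
  using assms unfolding minimal_invariant_set_def by blast

text \<open>
  Every point of a minimal set is diametral. The set \<open>Z\<close> of all points of \<open>K\<close> whose ball of radius \<open>r\<close>
  covers \<open>K\<close> is invariant: if \<open>v\<close> is such a point, then the ball around \<open>T v\<close> covers \<open>T ` K\<close>, so
  its intersection with \<open>K\<close> is invariant and equals \<open>K\<close> by minimality. Since \<open>z\<close> lies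
  in \<open>Z\<close>, minimality also gives \<open>Z = K\<close>, and then all mutual distances are at most \<open>r\<close>.
\<close>

lemma minimal_invariant_set_diametral:
  assumes min: "minimal_invariant_set T K" and T: "nonexpansive_on K T"
    and z: "z \<in> K" and r: "K \<subseteq> cball z r"
  shows "diameter K \<le> r"
proof -
  have K: "closed K" "convex K" "T ` K \<subseteq> K"
    using min by (auto simp: minimal_invariant_set_def invariant_set_def)
  have "r \<ge> 0" using z r by (auto dest: subsetD)
  define Z where "Z = K \<inter> (\<Inter>u\<in>K. cball u r)"
  have "T v \<in> Z" if v: "v \<in> Z" for v
  proof -
    have vK: "v \<in> K" and vr: "\<And>u. u \<in> K \<Longrightarrow> dist v u \<le> r"
      using v by (auto simp: Z_def dist_commute)
    have "invariant_set T (K \<inter> cball (T v) r)"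
      unfolding invariant_set_def
    proof (intro conjI)
      have "T v \<in> K \<inter> cball (T v) r" using K vK \<open>r \<ge> 0\<close> by auto
      then show "K \<inter> cball (T v) r \<noteq> {}" by blast
      show "T ` (K \<inter> cball (T v) r) \<subseteq> K \<inter> cball (T v) r"
      proof
        fix w assume "w \<in> T ` (K \<inter> cball (T v) r)"
        then obtain u where u: "u \<in> K" "w = T u" by blast
        have "norm (T v - T u) \<le> norm (v - u)" using T u vK by (simp add: nonexpansive_on_def)
        with vr[OF u(1)] u K show "w \<in> K \<inter> cball (T v) r" by (auto simp: dist_norm)
      qed
    qed (use K in \<open>auto intro: closed_Int convex_Int\<close>)
    from minimal_invariant_set_subset[OF min this]
    have "u \<in> K \<inter> cball (T v) r" if "u \<in> K" for u
      using that by blast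
    then show ?thesis using K vK by (auto simp: Z_def dist_commute)
  qed
  moreover have "z \<in> Z" using z r by (auto simp: Z_def dist_commute)
  ultimately have "invariant_set T Z"
    using K unfolding invariant_set_def Z_def
    by (auto intro!: closed_Int closed_INT convex_Int convex_INT)
  from minimal_invariant_set_subset[OF min this]
  have "u \<in> Z" if "u \<in> K" for u
    using that by (auto simp: Z_def)
  then have "dist u v \<le> r" if "u \<in> K" "v \<in> K" for u v
    using that by (auto simp: Z_def dist_commute)
  then show ?thesis using z by (intro diameter_le) (auto simp: dist_norm)
qed

text \<open>
  Suppose almost fixed points \<open>y\<^sub>n\<close> stay within \<open>\<rho> < diameter K\<close> of \<open>x\<close>. The points from which the
  \<open>y\<^sub>n\<close> are asymptotically within \<open>\<rho>\<close> form an invariant set, so by minimality all points of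
  \<open>K\<close> have this property. Hence finitely many balls of radius slightly above \<open>\<rho>\<close> with centres in \<open>K\<close>
  meet in a common \<open>y\<^sub>n\<close>, and by weak compactness all of them meet in one point of \<open>K\<close>. The ball
  around that point covers \<open>K\<close>, against diametrality.
\<close>

lemma goebel_karlovitz:
  fixes K :: "'a::real_normed_vector set"
  assumes cpt: "compactin weak_topology K"
    and min: "minimal_invariant_set T K" and T: "nonexpansive_on K T"
    and x: "x \<in> K" and \<eta>: "\<eta> > 0"
  shows "\<exists>\<epsilon>>0. \<forall>y\<in>K. norm (y - T y) \<le> \<epsilon> \<longrightarrow> diameter K - \<eta> \<le> norm (y - x)"
proof (rule ccontr)
  have K: "closed K" "convex K" "T ` K \<subseteq> K"
    using min by (auto simp: minimal_invariant_set_def invariant_set_def)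
  define \<rho> where "\<rho> = diameter K - \<eta>"
  assume "\<not> ?thesis"
  then have "\<exists>y\<in>K. norm (y - T y) \<le> \<epsilon> \<and> norm (y - x) < \<rho>" if "\<epsilon> > 0" for \<epsilon>
    using that unfolding \<rho>_def by (meson not_less)
  from this[of "inverse (real (Suc n))" for n]
  obtain y where y: "\<And>n. y n \<in> K" "\<And>n. norm (y n - T (y n)) \<le> inverse (real (Suc n))"
      "\<And>n. norm (y n - x) < \<rho>"
    by (simp del: of_nat_Suc) metis
  have "(\<lambda>n. norm (y n - T (y n))) \<longlonglongrightarrow> 0"
    by (rule tendsto_sandwich[OF _ _ tendsto_const LIMSEQ_inverse_real_of_nat]) (use y(2) in auto)
  then have small: "\<forall>\<^sub>F n in sequentially. norm (y n - T (y n)) < \<delta>" if "\<delta> > 0" for \<delta>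
    using that by (auto dest: order_tendstoD)
  define Z where "Z = {z \<in> K. \<forall>\<delta>>0. \<forall>\<^sub>F n in sequentially. norm (z - y n) < \<rho> + \<delta>}"
  have ZD: "\<forall>\<^sub>F n in sequentially. norm (z - y n) < \<rho> + \<delta>" if "z \<in> Z" "\<delta> > 0" for z \<delta>
    using that by (simp add: Z_def)
  have "invariant_set T Z"
    unfolding invariant_set_def
  proof (intro conjI)
    have "x \<in> Z"
      using x y(3) by (auto simp: Z_def norm_minus_commute add_strict_increasing2 less_imp_le add.commute
          intro!: always_eventually less_trans[of _ \<rho>])
    then show "Z \<noteq> {}" by blast
    show "closed Z"
      unfolding closed_sequential_limits
    proof (intro allI impI, elim conjE)
      fix z l assume z: "\<forall>k. z k \<in> Z" "z \<longlonglongrightarrow> l"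
      have "l \<in> K" using K(1) z closed_sequentially[of K z l] by (auto simp: Z_def)
      moreover have "\<forall>\<^sub>F n in sequentially. norm (l - y n) < \<rho> + \<delta>" if "\<delta> > 0" for \<delta>
      proof -
        have "\<forall>\<^sub>F k in sequentially. dist (z k) l < \<delta>/2"
          using z(2) that by (intro tendstoD) auto
        then obtain k where k: "dist (z k) l < \<delta>/2"
          using eventually_happens'[OF sequentially_bot] by blast
        have "\<forall>\<^sub>F n in sequentially. norm (z k - y n) < \<rho> + \<delta>/2"
          using z(1) that by (intro ZD) auto
        then show ?thesis
        proof eventually_elim
          case (elim n)
          have "norm (l - y n) \<le> norm (l - z k) + norm (z k - y n)"
            using norm_triangle_ineq[of "l - z k" "z k - y n"] by simp
          then show ?case using elim k by (simp add: dist_norm norm_minus_commute)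
        qed
      qed
      ultimately show "l \<in> Z" by (simp add: Z_def)
    qed
    show "convex Z"
      unfolding convex_alt
    proof (intro ballI allI impI)
      fix a b and t :: real assume a: "a \<in> Z" and b: "b \<in> Z" and t: "0 \<le> t \<and> t \<le> 1"
      have "(1 - t) *\<^sub>R a + t *\<^sub>R b \<in> K"
        using a b t K(2) unfolding convex_alt by (auto simp: Z_def)
      moreover have "\<forall>\<^sub>F n in sequentially. norm ((1 - t) *\<^sub>R a + t *\<^sub>R b - y n) < \<rho> + \<delta>"
        if "\<delta> > 0" for \<delta>
      proof -
        have "\<forall>\<^sub>F n in sequentially. norm (a - y n) < \<rho> + \<delta>"
          "\<forall>\<^sub>F n in sequentially. norm (b - y n) < \<rho> + \<delta>"
          using a b that by (auto simp: Z_def)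
        then show ?thesis
        proof eventually_elim
          case (elim n)
          then have "(1 - t) *\<^sub>R a + t *\<^sub>R b \<in> ball (y n) (\<rho> + \<delta>)"
            using t convex_ball[of "y n" "\<rho> + \<delta>"] unfolding convex_alt by (auto simp: dist_norm norm_minus_commute)
          then show ?case by (simp add: dist_norm norm_minus_commute)
        qed
      qed
      ultimately show "(1 - t) *\<^sub>R a + t *\<^sub>R b \<in> Z" by (simp add: Z_def)
    qed
    show "T ` Z \<subseteq> Z"
    proof
      fix w assume "w \<in> T ` Z"
      then obtain z where z: "z \<in> Z" "w = T z" by blast
      have "\<forall>\<^sub>F n in sequentially. norm (T z - y n) < \<rho> + \<delta>" if "\<delta> > 0" for \<delta>
      proof -
        have "\<forall>\<^sub>F n in sequentially. norm (z - y n) < \<rho> + \<delta>/2"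
          using z(1) that by (intro ZD) auto
        moreover have "\<forall>\<^sub>F n in sequentially. norm (y n - T (y n)) < \<delta>/2"
          using that by (intro small) auto
        ultimately show ?thesis
        proof eventually_elim
          case (elim n)
          have "norm (T z - y n) \<le> norm (T z - T (y n)) + norm (y n - T (y n))"
            using norm_triangle_ineq4[of "T z - T (y n)" "y n - T (y n)"] by simp
          also have "norm (T z - T (y n)) \<le> norm (z - y n)"
            using T z(1) y(1) by (simp add: nonexpansive_on_def Z_def)
          finally show ?case using elim by linarith
        qed
      qed
      then show "w \<in> Z" using z K(3) by (auto simp: Z_def)
    qed
  qed
  then have near: "\<forall>\<^sub>F n in sequentially. y n \<in> cball z (\<rho> + \<eta>/2)" if "z \<in> K" for z
  proof -
    have "z \<in> Z"
      by (rule minimal_invariant_set_subset[OF min \<open>invariant_set T Z\<close> _ that]) (auto simp: Z_def)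
    then have "\<forall>\<^sub>F n in sequentially. norm (z - y n) < \<rho> + \<eta>/2"
      using \<eta> by (intro ZD) auto
    then show ?thesis by eventually_elim (simp add: dist_norm)
  qed
  have "K \<inter> \<Inter> ((\<lambda>z. cball z (\<rho> + \<eta>/2)) ` K) \<noteq> {}"
  proof (rule weakly_compact_Inter_nonempty[OF cpt])
    fix \<F> assume "finite \<F>" "\<F> \<subseteq> (\<lambda>z. cball z (\<rho> + \<eta>/2)) ` K"
    then obtain S where S: "finite S" "S \<subseteq> K" "\<F> = (\<lambda>z. cball z (\<rho> + \<eta>/2)) ` S"
      by (meson finite_subset_image)
    then have "\<forall>\<^sub>F n in sequentially. \<forall>z\<in>S. y n \<in> cball z (\<rho> + \<eta>/2)"
      using near by (intro eventually_ball_finite) auto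
    then obtain n where "\<forall>z\<in>S. y n \<in> cball z (\<rho> + \<eta>/2)"
      using eventually_happens'[OF sequentially_bot] by blast
    then show "K \<inter> \<Inter>\<F> \<noteq> {}" using y(1)[of n] S(3) by blast
  qed auto
  then obtain z where "z \<in> K \<inter> \<Inter> ((\<lambda>z. cball z (\<rho> + \<eta>/2)) ` K)" by blast
  then have z: "z \<in> K" "\<And>u. u \<in> K \<Longrightarrow> z \<in> cball u (\<rho> + \<eta>/2)" by auto
  then have "diameter K \<le> \<rho> + \<eta>/2"
    by (intro minimal_invariant_set_diametral[OF min T z(1)]) (auto simp: dist_commute)
  then show False using \<eta> by (simp add: \<rho>_def)
qed

section \<open>Resolvents of a nonexpansive map\<close>

lemma resolvent_exists:
  fixes K :: "'a::banach set"
  assumes inv: "invariant_set T K" and T: "nonexpansive_on K T"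
    and s: "0 < s" "s \<le> 1" and u: "u \<in> K"
  obtains z where "z \<in> K" "z = (1 - s) *\<^sub>R T z + s *\<^sub>R u"
proof -
  have K: "closed K" "convex K" "T ` K \<subseteq> K"
    using inv by (auto simp: invariant_set_def)
  have "\<exists>!z\<in>K. (1 - s) *\<^sub>R T z + s *\<^sub>R u = z"
  proof (rule Banach_fix)
    show "complete K" using K(1) by (simp add: complete_eq_closed)
    show "(\<lambda>z. (1 - s) *\<^sub>R T z + s *\<^sub>R u) ` K \<subseteq> K"
      using K s u by (auto intro!: convexD)
    show "dist ((1 - s) *\<^sub>R T x + s *\<^sub>R u) ((1 - s) *\<^sub>R T y + s *\<^sub>R u) \<le> (1 - s) * dist x y"
      if "x \<in> K" "y \<in> K" for x y
      using T that s by (auto simp: dist_norm nonexpansive_on_def mult_left_mono simp flip: scaleR_diff_right)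
  qed (use s u in auto)
  then show thesis using that by metis
qed

text \<open>
  A resolvent \<open>x\<close> with step \<open>s\<close> at a fixed \<open>u\<close> satisfies \<open>x - T x = s (u - T x)\<close>; now let the steps
  tend to 0.
\<close>

lemma approximate_fixed_points:
  fixes K :: "'a::banach set"
  assumes inv: "invariant_set T K" and T: "nonexpansive_on K T" and K: "bounded K"
  obtains x where "\<And>n :: nat. x n \<in> K" "(\<lambda>n. norm (x n - T (x n))) \<longlonglongrightarrow> 0"
proof -
  obtain u where u: "u \<in> K" using inv by (auto simp: invariant_set_def)
  have "\<exists>x\<in>K. norm (x - T x) \<le> inverse (real (Suc n)) * diameter K" for n
  proof -
    let ?s = "inverse (real (Suc n))"
    obtain x where x: "x \<in> K" "x = (1 - ?s) *\<^sub>R T x + ?s *\<^sub>R u"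
      by (rule resolvent_exists[OF inv T _ _ u, of ?s]) (auto simp: inverse_le_1_iff)
    have "x - T x = ?s *\<^sub>R (u - T x)"
      by (subst x(2)) (simp add: algebra_simps)
    moreover have "norm (u - T x) \<le> diameter K"
      using diameter_bounded_bound[OF K u, of "T x"] x(1) inv by (auto simp: dist_norm invariant_set_def)
    ultimately show ?thesis using x(1)
      by (metis abs_of_nonneg inverse_nonnegative_iff_nonnegative mult_left_mono norm_scaleR of_nat_0_le_iff)
  qed
  then obtain x where x: "\<And>n. x n \<in> K" "\<And>n. norm (x n - T (x n)) \<le> inverse (real (Suc n)) * diameter K"
    by metis
  have "(\<lambda>n. inverse (real (Suc n)) * diameter K) \<longlonglongrightarrow> 0 * diameter K"
    by (intro tendsto_mult LIMSEQ_inverse_real_of_nat tendsto_const)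
  then have bound: "(\<lambda>n. inverse (real (Suc n)) * diameter K) \<longlonglongrightarrow> 0"
    by (simp only: mult_zero_left)
  have "(\<lambda>n. norm (x n - T (x n))) \<longlonglongrightarrow> 0"
    by (rule Lim_null_comparison[OF always_eventually bound]) (use x(2) in \<open>simp only: real_norm_def abs_norm_cancel simp_thms\<close>)
  with x(1) show thesis by (rule that)
qed

text \<open>
  Take \<open>u\<^sub>n = w\<^sub>n - b\<close> and \<open>v = b - c\<close>, where \<open>c\<close> is a weak limit of almost fixed points \<open>x\<^sub>n\<close> and
  \<open>b\<close> a weak limit of the resolvents \<open>w\<^sub>n\<close> at the midpoints of \<open>x\<^sub>n\<close> and \<open>c\<close>. The resolvents are a
  termwise version of the approximate fixed points that Lin's argument constructs in an ultrapower,
  and obey the same distance estimates.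
\<close>

lemma minimal_invariant_set_weak_splitting:
  fixes K :: "'a::banach set"
  assumes cpt: "compactin weak_topology K"
    and min: "minimal_invariant_set T K" and T: "nonexpansive_on K T"
    and d: "diameter K > 0" and \<eta>: "\<eta> > 0"
  obtains F :: "nat filter" and u :: "nat \<Rightarrow> 'a" and v where "F \<noteq> bot" "weakly_tendsto u 0 F"
    "\<And>n. norm (u n) \<le> diameter K / 2" "norm v \<le> diameter K / 2 + \<eta>"
    "\<And>n. norm (u n + v) \<ge> diameter K - \<eta>"
proof -
  define d where "d = diameter K"
  have inv: "invariant_set T K" using min by (simp add: minimal_invariant_set_def)
  then have K: "convex K" "T ` K \<subseteq> K" by (auto simp: invariant_set_def)
  have bdd: "bounded K" using cpt by (rule weakly_compact_imp_bounded)
  have diam: "norm (a - b) \<le> d" if "a \<in> K" "b \<in> K" for a b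
    using diameter_bounded_bound[OF bdd that] by (simp add: dist_norm d_def)
  obtain x where x: "\<And>n :: nat. x n \<in> K" "(\<lambda>n. norm (x n - T (x n))) \<longlonglongrightarrow> 0"
    using approximate_fixed_points[OF inv T bdd] by blast
  obtain F1 c where F1: "F1 \<le> sequentially" "F1 \<noteq> bot" "c \<in> K" "weakly_tendsto x c F1"
    using weakly_compact_cluster_point[OF cpt, of sequentially x] x(1) by auto
  obtain \<epsilon> where \<epsilon>: "\<epsilon> > 0" "\<And>y. y \<in> K \<Longrightarrow> norm (y - T y) \<le> \<epsilon> \<Longrightarrow> d - \<eta> \<le> norm (y - c)"
    using goebel_karlovitz[OF cpt min T F1(3) \<eta>] unfolding d_def by blast
  \<comment> \<open>The step \<open>s\<close> is fixed after \<open>c\<close>: a resolvent moves by at most \<open>s * d\<close> under \<open>T\<close>, so it is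
    fixed up to \<open>\<epsilon>\<close> and the Goebel-Karlovitz bound at \<open>c\<close> applies to it.\<close>
  define s where "s = min 1 (\<epsilon> / d)"
  have s: "0 < s" "s \<le> 1" "s * d \<le> \<epsilon>"
    using \<epsilon>(1) d by (auto simp: s_def d_def min_def field_simps)
  define m where "m n = (1/2) *\<^sub>R (x n + c)" for n
  have m: "m n \<in> K" for n
    using convexD[OF K(1) x(1) F1(3), of "1/2" "1/2" n] by (simp add: m_def scaleR_add_right)
  have "\<exists>z\<in>K. z = (1 - s) *\<^sub>R T z + s *\<^sub>R m n" for n
    using resolvent_exists[OF inv T s(1,2) m] by metis
  then obtain w where w: "\<And>n. w n \<in> K" "\<And>n. w n = (1 - s) *\<^sub>R T (w n) + s *\<^sub>R m n"
    by metis
  have Tne: "norm (T a - T b) \<le> norm (a - b)" if "a \<in> K" "b \<in> K" for a b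
    using T that by (simp add: nonexpansive_on_def)
  have w_c: "norm (w n - c) \<ge> d - \<eta>" for n
  proof (rule \<epsilon>(2)[OF w(1)])
    have "w n - T (w n) = s *\<^sub>R (m n - T (w n))"
      by (subst w(2)) (simp add: algebra_simps)
    also have "norm \<dots> = s * norm (m n - T (w n))" using s(1) by simp
    also have "\<dots> \<le> s * d"
      using s(1) m w(1) K(2) by (intro mult_left_mono diam) auto
    finally show "norm (w n - T (w n)) \<le> \<epsilon>" using s(3) by linarith
  qed
  have w_w: "norm (w j - w n) \<le> d / 2" for j n
  proof -
    have "w j - w n = (1 - s) *\<^sub>R (T (w j) - T (w n)) + s *\<^sub>R (m j - m n)"
      by (subst w(2)[of j], subst w(2)[of n]) (simp add: algebra_simps)
    also have "norm \<dots> \<le> (1 - s) * norm (T (w j) - T (w n)) + s * norm (m j - m n)"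
      using s by (intro norm_triangle_le) simp
    also have "\<dots> \<le> (1 - s) * norm (w j - w n) + s * (d / 2)"
    proof (intro add_mono mult_left_mono)
      have "m j - m n = (1/2) *\<^sub>R (x j - x n)" by (simp add: m_def algebra_simps)
      then show "norm (m j - m n) \<le> d / 2" using diam[OF x(1) x(1), of j n] by simp
    qed (use s w(1) Tne in auto)
    finally have "s * norm (w j - w n) \<le> s * (d / 2)" by (simp add: algebra_simps)
    then show ?thesis using s(1) by (simp only: mult_le_cancel_left_pos)
  qed
  have w_x: "norm (w n - x n) \<le> d / 2 + norm (x n - T (x n)) / s" for n
  proof -
    have "w n - x n = (1 - s) *\<^sub>R (T (w n) - T (x n)) + (1 - s) *\<^sub>R (T (x n) - x n) + s *\<^sub>R (m n - x n)"
      by (subst w(2)) (simp add: algebra_simps)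
    also have "norm \<dots> \<le> norm ((1 - s) *\<^sub>R (T (w n) - T (x n))) + norm ((1 - s) *\<^sub>R (T (x n) - x n)) + norm (s *\<^sub>R (m n - x n))"
      by (intro norm_triangle_le add_mono order_refl)
    also have "\<dots> = (1 - s) * norm (T (w n) - T (x n)) + (1 - s) * norm (x n - T (x n)) + s * norm (m n - x n)"
      using s by (simp add: norm_minus_commute)
    also have "\<dots> \<le> (1 - s) * norm (w n - x n) + norm (x n - T (x n)) + s * (d / 2)"
    proof (intro add_mono mult_left_mono)
      have "m n - x n = (1/2) *\<^sub>R (c - x n)"
        by (simp add: m_def algebra_simps flip: scaleR_left_distrib)
      then show "norm (m n - x n) \<le> d / 2" using diam[OF F1(3) x(1), of n] by simp
      show "(1 - s) * norm (x n - T (x n)) \<le> norm (x n - T (x n))"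
        using s by (simp add: mult_left_le_one_le)
    qed (use s w(1) x(1) Tne in auto)
    finally have "s * norm (w n - x n) \<le> norm (x n - T (x n)) + s * (d / 2)"
      by (simp add: algebra_simps)
    then show ?thesis using s(1) by (simp add: field_simps)
  qed
  obtain F b where F: "F \<le> F1" "F \<noteq> bot" "b \<in> K" "weakly_tendsto w b F"
    using weakly_compact_cluster_point[OF cpt F1(2), of w] w(1) by auto
  show thesis
  proof (rule that[of F "\<lambda>n. w n - b" "b - c"])
    show "F \<noteq> bot" by (rule F)
    show "weakly_tendsto (\<lambda>n. w n - b) 0 F"
      using weakly_tendsto_diff[OF F(4) weakly_tendsto_const[of b]] by simp
    show "norm (w n - b) \<le> diameter K / 2" for n
    proof (rule weak_limit_norm_le[OF _ F(2)])
      show "weakly_tendsto (\<lambda>j. w n - w j) (w n - b) F"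
        by (intro weakly_tendsto_diff weakly_tendsto_const F)
    qed (use w_w in \<open>auto simp: d_def\<close>)
    show "norm (b - c) \<le> diameter K / 2 + \<eta>"
    proof (rule weak_limit_norm_le[OF _ F(2)])
      show "weakly_tendsto (\<lambda>n. w n - x n) (b - c) F"
        by (intro weakly_tendsto_diff F weakly_tendsto_mono[OF F1(4) F(1)])
      have "\<forall>\<^sub>F n in sequentially. norm (x n - T (x n)) < s * \<eta>"
        using x(2) s(1) \<eta> by (intro order_tendstoD) auto
      then have "\<forall>\<^sub>F n in F. norm (x n - T (x n)) < s * \<eta>"
        using F(1) F1(1) by (meson filter_leD)
      then show "\<forall>\<^sub>F n in F. norm (w n - x n) \<le> diameter K / 2 + \<eta>"
      proof eventually_elim
        case (elim n)
        then have "norm (x n - T (x n)) / s < \<eta>" using s(1) by (simp add: field_simps)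
        then show ?case using w_x[of n] by (simp add: d_def)
      qed
    qed
    show "norm (w n - b + (b - c)) \<ge> diameter K - \<eta>" for n
      using w_c[of n] by (simp add: d_def)
  qed
qed

section \<open>The gap forced by the weak* uniform Kadec-Klee property\<close>

text \<open>
  The bound \<open>1/8\<close> on \<open>\<delta>\<close> makes the norming functionals \<open>3/4\<close>-separated, so the Kadec-Klee
  property applies to them with \<open>\<epsilon> = 1/2\<close>. Sequential compactness is used to pass to a weak* convergent
  subsequence of them.
\<close>

lemma weakly_null_sum_norm_bound:
  assumes seq_cpt: "seq_compactin weak_star_topology (cball (0 :: 'a::real_normed_vector \<Rightarrow>\<^sub>L real) 1)"
    and UKK: "dual_weak_star_UKK TYPE('a)"
  obtains \<delta> where "\<delta> > 0"
    "\<And>(F :: 'b filter) (u :: 'b \<Rightarrow> 'a) v. F \<noteq> bot \<Longrightarrow> weakly_tendsto u 0 F \<Longrightarrow>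
      (\<And>n. norm (u n) \<le> 1) \<Longrightarrow> norm v \<le> 1 \<Longrightarrow> \<exists>n. norm (u n + v) \<le> 2 - \<delta>"
proof -
  obtain \<delta>0 where \<delta>0: "\<delta>0 > 0" "\<And>(f :: nat \<Rightarrow> ('a \<Rightarrow>\<^sub>L real)) l. range f \<subseteq> cball 0 1 \<Longrightarrow>
      limitin weak_star_topology f l sequentially \<Longrightarrow> sep f > 1/2 \<Longrightarrow> norm l < 1 - \<delta>0"
    using UKK[unfolded dual_weak_star_UKK_def, rule_format, of "1/2"] by force
  define \<delta> where "\<delta> = min \<delta>0 (1/8)"
  have \<delta>: "\<delta> > 0" "\<delta> \<le> \<delta>0" "\<delta> \<le> 1/8" using \<delta>0(1) by (auto simp: \<delta>_def)
  have "\<exists>n. norm (u n + v) \<le> 2 - \<delta>"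
    if F: "F \<noteq> bot" and u: "weakly_tendsto u 0 F" "\<And>n. norm (u n) \<le> 1" and v: "norm v \<le> 1"
    for F :: "'b filter" and u :: "'b \<Rightarrow> 'a" and v
  proof (rule ccontr)
    assume "\<not> ?thesis"
    then have big: "norm (u n + v) > 2 - \<delta>" for n by (auto simp: not_le)
    have "\<exists>f :: 'a \<Rightarrow>\<^sub>L real. norm f \<le> 1 \<and> blinfun_apply f (u n + v) = norm (u n + v)" for n
      by (metis norming_functional)
    then obtain f :: "'b \<Rightarrow> 'a \<Rightarrow>\<^sub>L real"
      where f: "\<And>n. norm (f n) \<le> 1" "\<And>n. f n (u n + v) = norm (u n + v)"
      by metis
    have fu: "f n (u n) \<ge> 1 - \<delta>" and fv: "f n v \<ge> 1 - \<delta>" for n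
      using f(2)[of n] big[of n] blinfun_le_norm[OF f(1), of n "u n"] blinfun_le_norm[OF f(1), of n v] u(2)[of n] v
      by (auto simp: blinfun.add_right)
    \<comment> \<open>Each term is chosen so that all earlier functionals are small on it; this separates the
      functionals.\<close>
    have "\<exists>i. \<forall>k::nat. \<forall>j<k. f (i j) (u (i k)) \<le> \<delta>"
    proof (rule dependent_wellorder_choice)
      fix k :: nat and i :: "nat \<Rightarrow> 'b"
      have "((\<lambda>n. f (i j) (u n)) \<longlongrightarrow> 0) F" for j
        using u(1) unfolding weakly_tendsto_def by (metis blinfun.zero_right)
      then have "\<forall>\<^sub>F n in F. f (i j) (u n) < \<delta>" for j
        using \<delta>(1) order_tendstoD(2) by blast
      then have "\<forall>\<^sub>F n in F. \<forall>j\<in>{..<k}. f (i j) (u n) < \<delta>"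
        by (intro eventually_ball_finite) auto
      then obtain n where "\<forall>j\<in>{..<k}. f (i j) (u n) < \<delta>"
        using F eventually_happens' by blast
      then show "\<exists>n. \<forall>j<k. f (i j) (u n) \<le> \<delta>" by (auto intro: less_imp_le)
    qed auto
    then obtain i where i: "\<And>j k :: nat. j < k \<Longrightarrow> f (i j) (u (i k)) \<le> \<delta>" by blast
    have apart: "norm (f (i k) - f (i j)) \<ge> 3/4" if "j < k" for j k
    proof -
      have "f (i k) (u (i k)) - f (i j) (u (i k)) \<le> norm (f (i k) - f (i j)) * norm (u (i k))"
        using norm_blinfun[of "f (i k) - f (i j)" "u (i k)"] by (simp add: blinfun.diff_left)
      also have "\<dots> \<le> norm (f (i k) - f (i j))"
        using u(2)[of "i k"] by (simp add: mult_left_le)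
      finally show ?thesis using fu[of "i k"] i[OF that] \<delta>(3) by linarith
    qed
    have "range (\<lambda>k. f (i k)) \<subseteq> cball 0 1" using f(1) by auto
    then obtain l r where r: "strict_mono r"
      "limitin weak_star_topology ((\<lambda>k. f (i k)) \<circ> r) l sequentially"
      using seq_cpt unfolding seq_compactin_def by meson
    define g where "g k = f (i (r k))" for k
    have lim: "limitin weak_star_topology g l sequentially"
      using r(2) by (simp add: g_def[abs_def] o_def)
    have "norm (g n - g m) \<ge> 3/4" if "m \<noteq> n" for m n
      using apart[of "r m" "r n"] apart[of "r n" "r m"] that r(1)
      by (cases m n rule: linorder_cases) (auto simp: g_def strict_mono_less norm_minus_commute)
    then have "sep g \<ge> 3/4"
      unfolding sep_def by (intro cInf_greatest) (auto intro: exI[of _ "0::nat"] exI[of _ "1::nat"])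
    then have "norm l < 1 - \<delta>0"
      using f(1) by (intro \<delta>0(2)[OF _ lim]) (auto simp: g_def)
    moreover have "l v \<ge> 1 - \<delta>"
    proof (rule tendsto_lowerbound)
      show "(\<lambda>k. g k v) \<longlonglongrightarrow> l v" using lim by (simp add: limitin_weak_star_topology_iff)
    qed (use fv in \<open>auto simp: g_def\<close>)
    moreover have "l v \<le> norm l"
      using norm_blinfun[of l v] v mult_left_le[of "norm v" "norm l"] by simp
    ultimately show False using \<delta>(2) by linarith
  qed
  then show thesis using \<delta>(1) by (rule that[rotated])
qed

section \<open>The weak fixed point property\<close>

theorem theorem3:
  assumes "seq_compactin weak_star_topology (cball (0 :: 'a::banach \<Rightarrow>\<^sub>L real) 1)"
    and "dual_weak_star_UKK TYPE('a)"
  shows "weak_fixed_point_property TYPE('a)"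
  unfolding weak_fixed_point_property_def
proof (intro allI impI, elim conjE)
  fix C :: "'a set" and T
  assume C: "C \<noteq> {}" "compactin weak_topology C" "convex C"
    and TC: "T ` C \<subseteq> C" and T: "nonexpansive_on C T"
  have "invariant_set T C"
    using C TC weakly_compact_imp_closed by (auto simp: invariant_set_def)
  with C(2) obtain K where KC: "K \<subseteq> C" and min: "minimal_invariant_set T K"
    by (rule minimal_invariant_set_exists)
  then have K: "K \<noteq> {}" "closed K" "convex K" "T ` K \<subseteq> K"
    by (auto simp: minimal_invariant_set_def invariant_set_def)
  have cpt: "compactin weak_topology K"
    by (rule closed_compactin[OF C(2) KC closed_convex_imp_weakly_closed[OF K(2,3)]])
  have TK: "nonexpansive_on K T"
    using T KC by (auto simp: nonexpansive_on_def)
  have bdd: "bounded K" using cpt by (rule weakly_compact_imp_bounded)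
  define d where "d = diameter K"
  have "d \<le> 0"
  proof (rule ccontr)
    assume "\<not> d \<le> 0"
    then have d: "d > 0" by simp
    obtain \<delta> where \<delta>: "\<delta> > 0" "\<And>(F :: nat filter) (u :: nat \<Rightarrow> 'a) v. F \<noteq> bot \<Longrightarrow>
        weakly_tendsto u 0 F \<Longrightarrow> (\<And>n. norm (u n) \<le> 1) \<Longrightarrow> norm v \<le> 1 \<Longrightarrow>
        \<exists>n. norm (u n + v) \<le> 2 - \<delta>"
      using weakly_null_sum_norm_bound[OF assms] by blast
    \<comment> \<open>Rescaling by \<open>d / 2 + \<eta>\<close> and comparing with \<open>2 - \<delta>\<close> yields \<open>\<delta> * d / 2 < 3 * \<eta>\<close>, so any
      \<open>\<eta>\<close> up to \<open>\<delta> * d / 6\<close> is small enough.\<close>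
    define \<eta> where "\<eta> = \<delta> * d / 8"
    have \<eta>: "\<eta> > 0" using d \<delta>(1) by (simp add: \<eta>_def)
    obtain F :: "nat filter" and u :: "nat \<Rightarrow> 'a" and v where F: "F \<noteq> bot" "weakly_tendsto u 0 F"
      "\<And>n. norm (u n) \<le> d / 2" "norm v \<le> d / 2 + \<eta>" "\<And>n. norm (u n + v) \<ge> d - \<eta>"
      using minimal_invariant_set_weak_splitting[OF cpt min TK _ \<eta>] d unfolding d_def by blast
    define \<rho> where "\<rho> = d / 2 + \<eta>"
    have \<rho>: "\<rho> > 0" using d \<eta> by (simp add: \<rho>_def)
    have "\<exists>n. norm (u n /\<^sub>R \<rho> + v /\<^sub>R \<rho>) \<le> 2 - \<delta>"
    proof (rule \<delta>(2)[OF F(1)])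
      show "weakly_tendsto (\<lambda>n. u n /\<^sub>R \<rho>) 0 F"
        using F(2) by (auto simp: weakly_tendsto_def blinfun.scaleR_right intro!: tendsto_mult_right_zero)
      show "norm (u n /\<^sub>R \<rho>) \<le> 1" for n
        using F(3)[of n] \<eta> \<rho> by (simp add: \<rho>_def field_simps)
      show "norm (v /\<^sub>R \<rho>) \<le> 1"
        using F(4) \<rho> by (simp add: \<rho>_def field_simps)
    qed
    moreover have "norm (u n /\<^sub>R \<rho> + v /\<^sub>R \<rho>) = norm (u n + v) / \<rho>" for n
      using \<rho> by (simp add: divide_inverse mult.commute flip: scaleR_add_right)
    ultimately obtain n where "norm (u n + v) / \<rho> \<le> 2 - \<delta>" by auto
    then have "norm (u n + v) \<le> (2 - \<delta>) * \<rho>"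
      using \<rho> by (simp add: field_simps)
    with F(5)[of n] have "d - \<eta> \<le> (2 - \<delta>) * \<rho>" by linarith
    then have "\<delta> * d / 2 + \<delta> * \<eta> \<le> 3 * \<eta>" by (simp add: \<rho>_def field_simps)
    moreover have "\<delta> * \<eta> > 0" "\<delta> * d > 0" using \<delta>(1) \<eta> d by auto
    ultimately show False by (simp add: \<eta>_def)
  qed
  obtain x where x: "x \<in> K" using K(1) by blast
  then have "dist (T x) x \<le> d"
    unfolding d_def using K(4) by (intro diameter_bounded_bound bdd) auto
  with \<open>d \<le> 0\<close> have "dist (T x) x \<le> 0" by linarith
  then have "T x = x" by simp
  with x KC show "\<exists>x\<in>C. T x = x" by blast
qed

end
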